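(* The closure of a $\sigma$-compact subset of the subpower Higson corona of a proper unbounded metric space does not necessarily coincide with the Stone-Čech compactification of that subset. That is, there exist an unbounded proper metric space $(X,d)$ (with a basepoint $x_0\in X$) and a $\sigma$-compact subset $D\subset\nu_PX$ such that the closure $\overline{D}$ of $D$ in $\nu_PX$, regarded as a compactification of $D$, is not equivalent to the Stone-Čech compactification $\beta D$ (i.e. there is no homeomorphism $\beta D\to\overline{D}$ restricting to the identity on $D$).
   Context: A metric space is proper if each of its closed bounded subsets is compact. Let $(X,d)$ be an unbounded proper metric space with basepoint $x_0$; write $|x|=d(x,x_0)$ and let $B_r(x)$ denote the ball of radius $r$ centred at $x$. A function $p\colon\mathbb{R}_+\to\mathbb{R}_+$ is asymptotically subpower if for every $\alpha>0$ there exists $t_0>0$ such that $p(t)<t^\alpha$ for all $t>t_0$. A bounded continuous function $f\colon X\to\mathbb{R}$ is Higson subpower if for every asymptotically subpower function $p$ and every $\epsilon>0$ there exists $r_0>0$ such that $\mathrm{diam}(f(B_{p(|x|)}(x)))<\epsilon$ for all $x\in X$ with $|x|>r_0$. The Higson subpower functions form a closed subalgebra of the algebra of bounded continuous real functions on $X$; it contains the constants and separates points from closed sets. The Higson subpower compactification $h_PX$ is the (Hausdorff) compactification of $X$ corresponding to this subalgebra, i.e. the one for which a bounded continuous function $X\to\mathbb{R}$ extends continuously to $h_PX$ if and only if it is Higson subpower. The subpower Higson corona of $X$ is the remainder $\nu_PX=h_PX\setminus X$ with the subspace topology; it is a compact Hausdorff space. *)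

theory Defs
  imports "HOL-Analysis.Analysis"
begin

section \<open>Compactifications\<close>

definition is_compactification :: "'a topology \<Rightarrow> 'b topology \<Rightarrow> ('a \<Rightarrow> 'b) \<Rightarrow> bool" where
  "is_compactification X K e \<longleftrightarrow>
     compact_space K \<and> Hausdorff_space K \<and> embedding_map X K e \<and>
     K closure_of (e ` topspace X) = topspace K"

definition equivalent_compactifications ::
    "'a topology \<Rightarrow> 'b topology \<Rightarrow> ('a \<Rightarrow> 'b) \<Rightarrow> 'c topology \<Rightarrow> ('a \<Rightarrow> 'c) \<Rightarrow> bool" where
  "equivalent_compactifications X K e K' e' \<longleftrightarrow>
     (\<exists>h. homeomorphic_map K K' h \<and> (\<forall>x\<in>topspace X. h (e x) = e' x))"

definition extends_continuously ::
    "'a topology \<Rightarrow> 'b topology \<Rightarrow> ('a \<Rightarrow> 'b) \<Rightarrow> ('a \<Rightarrow> real) \<Rightarrow> bool" where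
  "extends_continuously X K e f \<longleftrightarrow>
     (\<exists>g. continuous_map K euclideanreal g \<and> (\<forall>x\<in>topspace X. g (e x) = f x))"

text \<open>Here and below the values of a function outside the space are irrelevant.\<close>

definition bounded_continuous :: "'a topology \<Rightarrow> ('a \<Rightarrow> real) set" where
  "bounded_continuous X =
     {f. continuous_map X euclideanreal f \<and> bounded (f ` topspace X)}"

text \<open>The compactification corresponding to a set \<open>F\<close> of bounded continuous functions: the closure
  of the image of the space in the product of real lines indexed by \<open>F\<close>. The theorems
  \<open>is_compactification_fun_compactification\<close> and \<open>extends_fun_compactification_iff\<close> below
  justify the name.\<close>

definition fun_embedding :: "('a \<Rightarrow> real) set \<Rightarrow> 'a \<Rightarrow> ('a \<Rightarrow> real) \<Rightarrow> real" where
  "fun_embedding F x = (\<lambda>f\<in>F. f x)"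

definition fun_compactification ::
    "'a topology \<Rightarrow> ('a \<Rightarrow> real) set \<Rightarrow> (('a \<Rightarrow> real) \<Rightarrow> real) topology" where
  "fun_compactification X F =
     subtopology (product_topology (\<lambda>_. euclideanreal) F)
       (product_topology (\<lambda>_. euclideanreal) F closure_of (fun_embedding F ` topspace X))"

abbreviation Stone_Cech :: "'a topology \<Rightarrow> (('a \<Rightarrow> real) \<Rightarrow> real) topology" where
  "Stone_Cech X \<equiv> fun_compactification X (bounded_continuous X)"

abbreviation Stone_Cech_embedding :: "'a topology \<Rightarrow> 'a \<Rightarrow> ('a \<Rightarrow> real) \<Rightarrow> real" where
  "Stone_Cech_embedding X \<equiv> fun_embedding (bounded_continuous X)"

definition sigma_compactin :: "'a topology \<Rightarrow> 'a set \<Rightarrow> bool" where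
  "sigma_compactin X S \<longleftrightarrow> (\<exists>C::nat \<Rightarrow> 'a set. (\<forall>n. compactin X (C n)) \<and> S = (\<Union>n. C n))"


section \<open>The subpower Higson corona\<close>

definition asymptotically_subpower :: "(real \<Rightarrow> real) \<Rightarrow> bool" where
  "asymptotically_subpower p \<longleftrightarrow>
     (\<forall>t\<ge>0. p t \<ge> 0) \<and> (\<forall>\<alpha>>0. \<exists>t0>0. \<forall>t>t0. p t < t powr \<alpha>)"

context Metric_space
begin

definition proper :: bool where
  "proper \<longleftrightarrow> (\<forall>S. closedin mtopology S \<and> mbounded S \<longrightarrow> compactin mtopology S)"

definition higson_subpower :: "'a \<Rightarrow> ('a \<Rightarrow> real) set" where
  "higson_subpower x0 =
     {f \<in> bounded_continuous mtopology.
        \<forall>p. asymptotically_subpower p \<longrightarrow>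
          (\<forall>\<epsilon>>0. \<exists>r0>0. \<forall>x\<in>M. d x x0 > r0 \<longrightarrow> diameter (f ` mball x (p (d x x0))) < \<epsilon>)}"

definition higson_compactification :: "'a \<Rightarrow> (('a \<Rightarrow> real) \<Rightarrow> real) topology" where
  "higson_compactification x0 = fun_compactification mtopology (higson_subpower x0)"

definition higson_embedding :: "'a \<Rightarrow> 'a \<Rightarrow> ('a \<Rightarrow> real) \<Rightarrow> real" where
  "higson_embedding x0 = fun_embedding (higson_subpower x0)"

definition higson_corona :: "'a \<Rightarrow> (('a \<Rightarrow> real) \<Rightarrow> real) topology" where
  "higson_corona x0 =
     subtopology (higson_compactification x0)
       (topspace (higson_compactification x0) - higson_embedding x0 ` M)"

end


section \<open>The characterizing properties of these compactifications\<close>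

lemma fun_embedding_apply: "f \<in> F \<Longrightarrow> fun_embedding F x f = f x"
  by (simp add: fun_embedding_def)

lemma continuous_map_fun_embedding:
  assumes "F \<subseteq> bounded_continuous X"
  shows "continuous_map X (product_topology (\<lambda>_. euclideanreal) F) (fun_embedding F)"
  using assms
  by (auto simp: continuous_map_componentwise fun_embedding_def bounded_continuous_def)

lemma topspace_fun_compactification:
  "topspace (fun_compactification X F) =
     product_topology (\<lambda>_. euclideanreal) F closure_of (fun_embedding F ` topspace X)"
  unfolding fun_compactification_def topspace_subtopology
  by (rule inf.absorb2) (rule closure_of_subset_topspace)

lemma fun_embedding_in_topspace:
  "x \<in> topspace X \<Longrightarrow> fun_embedding F x \<in> topspace (fun_compactification X F)"
  unfolding topspace_fun_compactification
  by (rule subsetD[OF closure_of_subset]) (auto simp: fun_embedding_def)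

theorem is_compactification_fun_compactification:
  assumes F: "F \<subseteq> bounded_continuous X" and "Hausdorff_space X"
    and sep: "\<And>C x. closedin X C \<Longrightarrow> x \<in> topspace X - C \<Longrightarrow> \<exists>f\<in>F. f x \<notin> closure (f ` C)"
  shows "is_compactification X (fun_compactification X F) (fun_embedding F)"
proof -
  let ?P = "product_topology (\<lambda>_. euclideanreal) F"
  let ?e = "fun_embedding F"
  have H: "Hausdorff_space ?P"
    by (simp add: Hausdorff_space_product_topology)
  let ?B = "PiE F (\<lambda>f. closure (f ` topspace X))"
  have cB: "compactin ?P ?B"
    using F by (auto simp: compactin_PiE bounded_continuous_def)
  have "closedin ?P ?B"
    using H cB by (rule compactin_imp_closedin)
  then have "?P closure_of (?e ` topspace X) \<subseteq> ?B"
    by (intro closure_of_minimal) (auto simp: fun_embedding_def closure_subset[THEN subsetD])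
  then have "compactin ?P (?P closure_of (?e ` topspace X))"
    using cB closed_compactin closedin_closure_of by blast
  then have comp: "compact_space (fun_compactification X F)"
    by (simp add: fun_compactification_def compact_space_subtopology)
  have inj: "inj_on ?e (topspace X)"
  proof (rule inj_onI, rule ccontr)
    fix x y assume xy: "x \<in> topspace X" "y \<in> topspace X" "?e x = ?e y" "x \<noteq> y"
    then obtain f where "f \<in> F" "f x \<notin> closure (f ` {y})"
      using sep[of "{y}" x] assms(2) by (auto simp: closedin_Hausdorff_singleton)
    then show False
      using xy(3) fun_embedding_apply[of f F x] fun_embedding_apply[of f F y] by simp
  qed
  have cont: "continuous_map X ?P ?e"
    by (rule continuous_map_fun_embedding[OF F])
  have "closed_map X (subtopology ?P (?e ` topspace X)) ?e"
    unfolding closed_map_def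
  proof (intro allI impI)
    fix C assume C: "closedin X C"
    have "?e ` C = ?e ` topspace X \<inter> ?P closure_of (?e ` C)"
    proof
      show "?e ` C \<subseteq> ?e ` topspace X \<inter> ?P closure_of (?e ` C)"
        using closedin_subset[OF C] cont
        by (intro Int_greatest image_mono closure_of_subset)
          (auto simp: continuous_map_def)
      show "?e ` topspace X \<inter> ?P closure_of (?e ` C) \<subseteq> ?e ` C"
      proof clarify
        fix x assume x: "x \<in> topspace X" and cl: "?e x \<in> ?P closure_of (?e ` C)"
        show "?e x \<in> ?e ` C"
        proof (rule ccontr)
          assume "?e x \<notin> ?e ` C"
          then obtain f where f: "f \<in> F" "f x \<notin> closure (f ` C)"
            using sep[OF C, of x] x by blast
          have "continuous_map ?P euclideanreal (\<lambda>y. y f)"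
            using f(1) by (rule continuous_map_product_projection)
          then have "(\<lambda>y. y f) ` (?P closure_of (?e ` C)) \<subseteq> euclideanreal closure_of ((\<lambda>y. y f) ` ?e ` C)"
            by (rule continuous_map_image_closure_subset)
          then have "?e x f \<in> closure ((\<lambda>y. y f) ` ?e ` C)"
            using cl by auto
          also have "(\<lambda>y. y f) ` ?e ` C = f ` C"
            using f(1) by (auto simp: image_image fun_embedding_apply)
          finally show False
            using f by (simp add: fun_embedding_apply)
        qed
      qed
    qed
    then show "closedin (subtopology ?P (?e ` topspace X)) (?e ` C)"
      unfolding closedin_subtopology by (metis closedin_closure_of inf_commute)
  qed
  then have "embedding_map X (subtopology ?P (?e ` topspace X)) ?e"
    using cont inj by (intro injective_closed_imp_embedding_map)
      (auto simp: continuous_map_in_subtopology)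
  then have emb0: "embedding_map X ?P ?e"
    by (simp add: embedding_map_in_subtopology)
  have sub: "?e ` topspace X \<subseteq> ?P closure_of (?e ` topspace X)"
    using cont by (intro closure_of_subset) (auto simp: continuous_map_def)
  have emb: "embedding_map X (fun_compactification X F) ?e"
    using emb0 sub by (simp add: fun_compactification_def embedding_map_in_subtopology)
  have "fun_compactification X F closure_of (?e ` topspace X) = topspace (fun_compactification X F)"
    using sub unfolding topspace_fun_compactification
    by (simp add: fun_compactification_def closure_of_subtopology inf.absorb2)
  then show ?thesis
    using comp H emb
    by (simp add: is_compactification_def fun_compactification_def Hausdorff_space_subtopology)
qed

lemma extends_fun_compactification:
  assumes "f \<in> F"
  shows "extends_continuously X (fun_compactification X F) (fun_embedding F) f"
  unfolding extends_continuously_def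
proof (intro exI conjI ballI)
  show "continuous_map (fun_compactification X F) euclideanreal (\<lambda>y. y f)"
    unfolding fun_compactification_def
    by (intro continuous_map_from_subtopology continuous_map_product_projection assms)
qed (simp add: assms fun_embedding_apply)

text \<open>The Stone-Weierstrass theorem of the library is stated for Hausdorff types.\<close>

instance "fun" :: (type, t0_space) t0_space
proof
  fix f g :: "'a \<Rightarrow> 'b" assume "f \<noteq> g"
  then obtain x where "f x \<noteq> g x" by auto
  then obtain U where U: "open U" "\<not> (f x \<in> U \<longleftrightarrow> g x \<in> U)"
    using t0_space_class.t0_space[OF \<open>f x \<noteq> g x\<close>] by blast
  have "open ((\<lambda>h::'a \<Rightarrow> 'b. h x) -` U)"
    using U by (auto intro!: open_vimage continuous_on_product_coordinates)
  then show "\<exists>U. open U \<and> \<not> (f \<in> U \<longleftrightarrow> g \<in> U)"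
    using U by (intro exI[of _ "(\<lambda>h. h x) -` U"]) auto
qed

instance "fun" :: (type, t1_space) t1_space
proof
  fix f g :: "'a \<Rightarrow> 'b" assume "f \<noteq> g"
  then obtain x where "f x \<noteq> g x" by auto
  then obtain U where U: "open U" "f x \<in> U" "g x \<notin> U"
    using t1_space[OF \<open>f x \<noteq> g x\<close>] by blast
  have "open ((\<lambda>h::'a \<Rightarrow> 'b. h x) -` U)"
    using U by (auto intro!: open_vimage continuous_on_product_coordinates)
  then show "\<exists>U. open U \<and> f \<in> U \<and> g \<notin> U"
    using U by (intro exI[of _ "(\<lambda>h. h x) -` U"]) auto
qed

instance "fun" :: (type, t2_space) t2_space
proof
  fix f g :: "'a \<Rightarrow> 'b" assume "f \<noteq> g"
  then obtain x where "f x \<noteq> g x" by auto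
  then obtain U V where UV: "open U" "open V" "f x \<in> U" "g x \<in> V" "U \<inter> V = {}"
    using hausdorff by metis
  have "open ((\<lambda>h::'a \<Rightarrow> 'b. h x) -` U)" "open ((\<lambda>h::'a \<Rightarrow> 'b. h x) -` V)"
    using UV by (auto intro!: open_vimage continuous_on_product_coordinates)
  then show "\<exists>U V. open U \<and> open V \<and> f \<in> U \<and> g \<in> V \<and> U \<inter> V = {}"
    using UV by (intro exI[of _ "(\<lambda>h. h x) -` U"] exI[of _ "(\<lambda>h. h x) -` V"]) auto
qed

lemma fun_compactification_eq_top_of_set:
  "fun_compactification X F = top_of_set (topspace (fun_compactification X F))"
proof -
  let ?P = "product_topology (\<lambda>_. euclideanreal) F"
  let ?K = "topspace (fun_compactification X F)"
  have K: "fun_compactification X F = subtopology ?P ?K"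
    unfolding topspace_fun_compactification by (simp only: fun_compactification_def)
  have KE: "?K \<subseteq> extensional F"
    unfolding topspace_fun_compactification
    using closure_of_subset_topspace[of ?P] by (fastforce simp: PiE_def)
  have "continuous_map (subtopology ?P ?K) (product_topology (\<lambda>_. euclideanreal) UNIV) (\<lambda>y. y)"
    unfolding continuous_map_componentwise_UNIV
  proof
    fix f :: "'a \<Rightarrow> real"
    show "continuous_map (subtopology ?P ?K) euclideanreal (\<lambda>y. y f)"
    proof (cases "f \<in> F")
      case True
      then show ?thesis
        by (intro continuous_map_from_subtopology continuous_map_product_projection)
    next
      case False
      have "continuous_map (subtopology ?P ?K) euclideanreal (\<lambda>y. undefined)"
        by simp
      then show ?thesis
        by (rule continuous_map_eq) (use False KE in \<open>auto simp: extensional_def\<close>)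
    qed
  qed
  then have 1: "continuous_map (subtopology ?P ?K) (top_of_set ?K) (\<lambda>y. y)"
    by (auto simp: euclidean_product_topology continuous_map_in_subtopology)
  have "continuous_map (top_of_set ?K) ?P (\<lambda>y. y)"
    using KE by (auto simp: continuous_map_componentwise
        intro!: continuous_on_subset[OF continuous_on_product_coordinates])
  then have 2: "continuous_map (top_of_set ?K) (subtopology ?P ?K) (\<lambda>y. y)"
    by (auto simp: continuous_map_in_subtopology)
  have "topspace (subtopology ?P ?K) = ?K"
    using K by metis
  then have "subtopology ?P ?K = top_of_set ?K"
    using 1 2 topology_finer_continuous_id[of "subtopology ?P ?K" "top_of_set ?K"]
      topology_finer_continuous_id[of "top_of_set ?K" "subtopology ?P ?K"]
    by (auto simp: id_def topology_eq)
  then show ?thesis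
    using K by simp
qed

theorem extends_fun_compactification_iff:
  assumes F: "F \<subseteq> bounded_continuous X" 
    and const: "\<And>c. (\<lambda>_. c) \<in> F"
    and add: "\<And>f g. f \<in> F \<Longrightarrow> g \<in> F \<Longrightarrow> (\<lambda>x. f x + g x) \<in> F"
    and mult: "\<And>f g. f \<in> F \<Longrightarrow> g \<in> F \<Longrightarrow> (\<lambda>x. f x * g x) \<in> F"
    and closed: "\<And>f. (\<And>\<epsilon>. \<epsilon> > 0 \<Longrightarrow> \<exists>g\<in>F. \<forall>x\<in>topspace X. \<bar>f x - g x\<bar> < \<epsilon>) \<Longrightarrow> f \<in> F"
    and comp: "compact_space (fun_compactification X F)"
  shows "extends_continuously X (fun_compactification X F) (fun_embedding F) f \<longleftrightarrow> f \<in> F"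
proof
  assume "extends_continuously X (fun_compactification X F) (fun_embedding F) f"
  then obtain g where g: "continuous_map (fun_compactification X F) euclideanreal g"
      "\<And>x. x \<in> topspace X \<Longrightarrow> g (fun_embedding F x) = f x"
    by (auto simp: extends_continuously_def)
  define K where "K = topspace (fun_compactification X F)"
  have top: "fun_compactification X F = top_of_set K"
    unfolding K_def by (rule fun_compactification_eq_top_of_set)
  define Q where "Q h \<longleftrightarrow> continuous_on K h \<and> (\<exists>k\<in>F. \<forall>x\<in>topspace X. h (fun_embedding F x) = k x)"
    for h :: "(('a \<Rightarrow> real) \<Rightarrow> real) \<Rightarrow> real"
  show "f \<in> F"
  proof (rule closed)
    fix \<epsilon> :: real assume "\<epsilon> > 0"
    have "\<exists>h. Q h \<and> (\<forall>y\<in>K. \<bar>g y - h y\<bar> < \<epsilon>)"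
    proof (rule Stone_Weierstrass_HOL)
      show "compact K"
        using comp unfolding top by (simp add: compact_space_subtopology compact_space_def)
      show "Q (\<lambda>y. c)" for c
        using const by (auto simp: Q_def)
      show "Q h \<Longrightarrow> continuous_on K h" for h
        by (simp add: Q_def)
      show "Q (\<lambda>y. h y + k y)" if hk: "Q h \<and> Q k" for h k
      proof -
        obtain u v where uv: "u \<in> F" "v \<in> F" "continuous_on K h" "continuous_on K k"
            "\<forall>x\<in>topspace X. h (fun_embedding F x) = u x"
            "\<forall>x\<in>topspace X. k (fun_embedding F x) = v x"
          using hk unfolding Q_def by blast
        then show ?thesis
          unfolding Q_def
          by (intro conjI continuous_on_add bexI[of _ "\<lambda>x. u x + v x"] add) auto
      qed
      show "Q (\<lambda>y. h y * k y)" if hk: "Q h \<and> Q k" for h k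
      proof -
        obtain u v where uv: "u \<in> F" "v \<in> F" "continuous_on K h" "continuous_on K k"
            "\<forall>x\<in>topspace X. h (fun_embedding F x) = u x"
            "\<forall>x\<in>topspace X. k (fun_embedding F x) = v x"
          using hk unfolding Q_def by blast
        then show ?thesis
          unfolding Q_def
          by (intro conjI continuous_on_mult bexI[of _ "\<lambda>x. u x * v x"] mult) auto
      qed
      show "continuous_on K g"
        using g(1) by (simp add: top)
      show "\<exists>h. Q h \<and> h y \<noteq> h z" if yz: "y \<in> K \<and> z \<in> K \<and> y \<noteq> z" for y z
      proof -
        have "K \<subseteq> extensional F"
          unfolding K_def topspace_fun_compactification
          using closure_of_subset_topspace[of "product_topology (\<lambda>_. euclideanreal) F"]
          by (fastforce simp: PiE_def)
        with yz obtain k where "k \<in> F" "y k \<noteq> z k"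
          by (metis extensionalityI subsetD)
        then have "Q (\<lambda>y. y k)"
          unfolding Q_def by (auto simp: fun_embedding_apply
              intro!: continuous_on_subset[OF continuous_on_product_coordinates])
        with \<open>y k \<noteq> z k\<close> show ?thesis by blast
      qed
    qed fact
    then show "\<exists>k\<in>F. \<forall>x\<in>topspace X. \<bar>f x - k x\<bar> < \<epsilon>"
      using g(2) fun_embedding_in_topspace[of _ X F] unfolding Q_def K_def by metis
  qed
qed (rule extends_fun_compactification)

theorem is_compactification_Stone_Cech:
  assumes "completely_regular_space X" "Hausdorff_space X"
  shows "is_compactification X (Stone_Cech X) (Stone_Cech_embedding X)"
proof (rule is_compactification_fun_compactification)
  fix C x assume "closedin X C" "x \<in> topspace X - C"
  then obtain f where f: "continuous_map X (top_of_set {0..1::real}) f" "f x = 0" "f ` C \<subseteq> {1}"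
    using assms(1) unfolding completely_regular_space_def by blast
  then have "f \<in> bounded_continuous X"
    unfolding bounded_continuous_def continuous_map_in_subtopology
    by (auto intro: bounded_subset[of "{0..1}"])
  moreover have "f x \<notin> closure (f ` C)"
    using closure_mono[OF f(3)] f(2) by auto
  ultimately show "\<exists>f\<in>bounded_continuous X. f x \<notin> closure (f ` C)"
    by blast
qed (use assms in auto)

context Metric_space
begin

lemma higson_subpower_iff:
  "f \<in> higson_subpower x0 \<longleftrightarrow> f \<in> bounded_continuous mtopology \<and>
     (\<forall>p. asymptotically_subpower p \<longrightarrow>
        (\<forall>\<epsilon>>0. \<exists>r0>0. \<forall>x\<in>M. d x x0 > r0 \<longrightarrow>
           (\<forall>y\<in>mball x (p (d x x0)). \<forall>z\<in>mball x (p (d x x0)). \<bar>f y - f z\<bar> < \<epsilon>)))"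
  (is "?L \<longleftrightarrow> ?R")
proof
  assume L: ?L
  show ?R
  proof (intro conjI allI impI)
    show "f \<in> bounded_continuous mtopology"
      using L by (simp add: higson_subpower_def)
    then have bd: "bounded (f ` M)"
      by (simp add: bounded_continuous_def)
    fix p and \<epsilon> :: real assume "asymptotically_subpower p" "\<epsilon> > 0"
    then obtain r0 where r0: "r0 > 0"
      "\<And>x. x \<in> M \<Longrightarrow> d x x0 > r0 \<Longrightarrow> diameter (f ` mball x (p (d x x0))) < \<epsilon>"
      using L unfolding higson_subpower_def by blast
    have "\<bar>f y - f z\<bar> < \<epsilon>" if "x \<in> M" "d x x0 > r0" "y \<in> mball x (p (d x x0))"
      "z \<in> mball x (p (d x x0))" for x y z
    proof -
      have "bounded (f ` mball x (p (d x x0)))"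
        by (rule bounded_subset[OF bd]) auto
      then have "dist (f y) (f z) \<le> diameter (f ` mball x (p (d x x0)))"
        using that by (intro diameter_bounded_bound) blast+
      then show ?thesis
        using r0(2)[OF that(1,2)] by (simp add: dist_real_def)
    qed
    then show "\<exists>r0>0. \<forall>x\<in>M. d x x0 > r0 \<longrightarrow>
           (\<forall>y\<in>mball x (p (d x x0)). \<forall>z\<in>mball x (p (d x x0)). \<bar>f y - f z\<bar> < \<epsilon>)"
      using r0(1) by blast
  qed
next
  assume R: ?R
  have "\<exists>r0>0. \<forall>x\<in>M. d x x0 > r0 \<longrightarrow> diameter (f ` mball x (p (d x x0))) < \<epsilon>"
    if p: "asymptotically_subpower p" and e: "\<epsilon> > 0" for p \<epsilon>
  proof -
    have "\<epsilon>/2 > 0" using e by simp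
    then obtain r0 where r0: "r0 > 0" "\<And>x y z. x \<in> M \<Longrightarrow> d x x0 > r0 \<Longrightarrow> y \<in> mball x (p (d x x0)) \<Longrightarrow>
       z \<in> mball x (p (d x x0)) \<Longrightarrow> \<bar>f y - f z\<bar> < \<epsilon>/2"
      using R p by meson
    have "diameter (f ` mball x (p (d x x0))) \<le> \<epsilon>/2" if x: "x \<in> M" "d x x0 > r0" for x
      using e r0(2)[OF x] by (intro diameter_le) (auto simp del: in_mball intro: less_imp_le)
    then show ?thesis
      using r0(1) e by (intro exI[of _ r0]) fastforce
  qed
  then show ?L
    using R by (simp add: higson_subpower_def)
qed

lemma higson_subpower_const: "(\<lambda>_. c) \<in> higson_subpower x0"
  by (auto simp: higson_subpower_iff bounded_continuous_def bounded_iff intro: exI[of _ 1])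

lemma higson_subpower_lipschitz2:
  assumes f: "f \<in> higson_subpower x0" and g: "g \<in> higson_subpower x0"
    and h: "h \<in> bounded_continuous mtopology" and "B \<ge> 0"
    and bnd: "\<And>y z. y \<in> M \<Longrightarrow> z \<in> M \<Longrightarrow> \<bar>h y - h z\<bar> \<le> B * (\<bar>f y - f z\<bar> + \<bar>g y - g z\<bar>)"
  shows "h \<in> higson_subpower x0"
  unfolding higson_subpower_iff
proof (intro conjI allI impI)
  fix p and \<epsilon> :: real assume p: "asymptotically_subpower p" and e: "\<epsilon> > 0"
  define \<delta> where "\<delta> = \<epsilon> / (2 * (B + 1))"
  have \<delta>: "\<delta> > 0" using e \<open>B \<ge> 0\<close> by (simp add: \<delta>_def)
  obtain r1 where r1: "r1 > 0" "\<And>x y z. x \<in> M \<Longrightarrow> d x x0 > r1 \<Longrightarrow> y \<in> mball x (p (d x x0)) \<Longrightarrow>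
       z \<in> mball x (p (d x x0)) \<Longrightarrow> \<bar>f y - f z\<bar> < \<delta>"
    using f[unfolded higson_subpower_iff] p \<delta> by meson
  obtain r2 where r2: "r2 > 0" "\<And>x y z. x \<in> M \<Longrightarrow> d x x0 > r2 \<Longrightarrow> y \<in> mball x (p (d x x0)) \<Longrightarrow>
       z \<in> mball x (p (d x x0)) \<Longrightarrow> \<bar>g y - g z\<bar> < \<delta>"
    using g[unfolded higson_subpower_iff] p \<delta> by meson
  have "\<bar>h y - h z\<bar> < \<epsilon>" if x: "x \<in> M" "d x x0 > max r1 r2"
    and yz: "y \<in> mball x (p (d x x0))" "z \<in> mball x (p (d x x0))" for x y z
  proof -
    have "\<bar>f y - f z\<bar> < \<delta>" "\<bar>g y - g z\<bar> < \<delta>"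
      using r1(2)[OF x(1) _ yz] r2(2)[OF x(1) _ yz] x(2) by auto
    then have "B * (\<bar>f y - f z\<bar> + \<bar>g y - g z\<bar>) \<le> B * (2 * \<delta>)"
      using \<open>B \<ge> 0\<close> by (intro mult_left_mono) auto
    also have "\<dots> < (B + 1) * (2 * \<delta>)"
      using \<delta> by simp
    also have "\<dots> = \<epsilon>"
      using \<open>B \<ge> 0\<close> by (simp add: \<delta>_def field_simps)
    finally show ?thesis
      using bnd[of y z] yz by auto
  qed
  then show "\<exists>r0>0. \<forall>x\<in>M. d x x0 > r0 \<longrightarrow>
       (\<forall>y\<in>mball x (p (d x x0)). \<forall>z\<in>mball x (p (d x x0)). \<bar>h y - h z\<bar> < \<epsilon>)"
    using r1(1) by (intro exI[of _ "max r1 r2"]) auto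
qed (rule h)

lemma bounded_continuous_bound:
  assumes "f \<in> bounded_continuous mtopology"
  obtains B where "B > 0" "\<And>x. x \<in> M \<Longrightarrow> \<bar>f x\<bar> \<le> B"
proof -
  obtain B where "B > 0" "\<forall>y\<in>f ` M. norm y \<le> B"
    using assms by (auto simp: bounded_continuous_def bounded_pos)
  then show ?thesis
    by (intro that[of B]) auto
qed

lemma higson_subpower_add:
  assumes "f \<in> higson_subpower x0" "g \<in> higson_subpower x0"
  shows "(\<lambda>x. f x + g x) \<in> higson_subpower x0"
proof (rule higson_subpower_lipschitz2[OF assms, where B = 1])
  show "(\<lambda>x. f x + g x) \<in> bounded_continuous mtopology"
    using assms
    by (auto simp: higson_subpower_def bounded_continuous_def intro: continuous_map_add bounded_plus_comp)
qed auto

lemma higson_subpower_mult: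
  assumes "f \<in> higson_subpower x0" "g \<in> higson_subpower x0"
  shows "(\<lambda>x. f x * g x) \<in> higson_subpower x0"
proof -
  have fg: "f \<in> bounded_continuous mtopology" "g \<in> bounded_continuous mtopology"
    using assms by (auto simp: higson_subpower_def)
  obtain A where A: "A > 0" "\<And>x. x \<in> M \<Longrightarrow> \<bar>f x\<bar> \<le> A"
    using bounded_continuous_bound[OF fg(1)] by metis
  obtain B where B: "B > 0" "\<And>x. x \<in> M \<Longrightarrow> \<bar>g x\<bar> \<le> B"
    using bounded_continuous_bound[OF fg(2)] by metis
  show ?thesis
  proof (rule higson_subpower_lipschitz2[OF assms, where B = "max A B"])
    have "\<bar>f x * g x\<bar> \<le> A * B" if "x \<in> M" for x
      using A(2)[OF that] B(2)[OF that] by (simp add: abs_mult mult_mono)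
    then have "bounded ((\<lambda>x. f x * g x) ` M)"
      by (auto simp: bounded_iff)
    then show "(\<lambda>x. f x * g x) \<in> bounded_continuous mtopology"
      using fg by (auto simp: bounded_continuous_def intro: continuous_map_real_mult)
    show "\<bar>f y * g y - f z * g z\<bar> \<le> max A B * (\<bar>f y - f z\<bar> + \<bar>g y - g z\<bar>)"
      if "y \<in> M" "z \<in> M" for y z
    proof -
      have "f y * g y - f z * g z = g y * (f y - f z) + f z * (g y - g z)"
        by (simp add: algebra_simps)
      then have "\<bar>f y * g y - f z * g z\<bar> \<le> \<bar>g y\<bar> * \<bar>f y - f z\<bar> + \<bar>f z\<bar> * \<bar>g y - g z\<bar>"
        by (metis abs_mult abs_triangle_ineq)
      also have "\<dots> \<le> max A B * \<bar>f y - f z\<bar> + max A B * \<bar>g y - g z\<bar>"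
        using A(2)[OF that(2)] B(2)[OF that(1)] by (intro add_mono mult_right_mono) auto
      finally show ?thesis by (simp add: algebra_simps)
    qed
  qed (use A in auto)
qed

lemma higson_subpower_closed:
  assumes lim: "\<And>\<epsilon>. \<epsilon> > 0 \<Longrightarrow> \<exists>g\<in>higson_subpower x0. \<forall>x\<in>M. \<bar>f x - g x\<bar> < \<epsilon>"
  shows "f \<in> higson_subpower x0"
proof -
  have cont: "continuous_map mtopology euclideanreal f"
  proof -
    have "\<exists>g. continuous_map mtopology euclideanreal g \<and> (\<forall>x\<in>M. \<bar>f x - g x\<bar> < \<epsilon>)" if "\<epsilon> > 0" for \<epsilon>
      using lim[OF that] by (auto simp: higson_subpower_def bounded_continuous_def)
    then obtain G where G: "\<And>\<epsilon>. \<epsilon> > 0 \<Longrightarrow> continuous_map mtopology euclideanreal (G \<epsilon>)"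
      "\<And>\<epsilon> x. \<epsilon> > 0 \<Longrightarrow> x \<in> M \<Longrightarrow> \<bar>f x - G \<epsilon> x\<bar> < \<epsilon>"
      by metis
    have "\<exists>\<delta>>0. \<forall>y. y \<in> M \<and> d x y < \<delta> \<longrightarrow> \<bar>f x - f y\<bar> < \<epsilon>" if x: "x \<in> M" and e: "\<epsilon> > 0" for x \<epsilon>
    proof -
      have e3: "\<epsilon>/3 > 0" using e by simp
      have "\<exists>\<delta>>0. \<forall>y. y \<in> M \<and> d x y < \<delta> \<longrightarrow> dist (G (\<epsilon>/3) x) (G (\<epsilon>/3) y) < \<epsilon>/3"
        using G(1)[OF e3] x e3 metric_continuous_map[OF Met_TC.Metric_space_axioms, of "G (\<epsilon>/3)"]
        by (simp del: divide_const_simps less_divide_eq_numeral1)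
      then obtain \<delta> where \<delta>: "\<delta> > 0" "\<And>y. y \<in> M \<Longrightarrow> d x y < \<delta> \<Longrightarrow> \<bar>G (\<epsilon>/3) x - G (\<epsilon>/3) y\<bar> < \<epsilon>/3"
        by (auto simp: dist_real_def)
      have "\<bar>f x - f y\<bar> < \<epsilon>" if "y \<in> M" "d x y < \<delta>" for y
        using G(2)[OF e3 x] G(2)[OF e3 that(1)] \<delta>(2)[OF that] by linarith
      then show ?thesis using \<delta>(1) by blast
    qed
    then show ?thesis
      using metric_continuous_map[OF Met_TC.Metric_space_axioms, of f]
      by (simp add: dist_real_def)
  qed
  obtain g where g: "g \<in> higson_subpower x0" "\<And>x. x \<in> M \<Longrightarrow> \<bar>f x - g x\<bar> < 1"
    using lim[of 1] by auto
  then have "g \<in> bounded_continuous mtopology" by (simp add: higson_subpower_def)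
  then obtain B where B: "\<And>x. x \<in> M \<Longrightarrow> \<bar>g x\<bar> \<le> B"
    using bounded_continuous_bound by metis
  have "\<bar>f x\<bar> \<le> B + 1" if "x \<in> M" for x
    using g(2)[OF that] B[OF that] by linarith
  then have "bounded (f ` M)"
    by (auto simp: bounded_iff)
  with cont have bc: "f \<in> bounded_continuous mtopology"
    by (simp add: bounded_continuous_def)
  show ?thesis
    unfolding higson_subpower_iff
  proof (intro conjI allI impI)
    fix p and \<epsilon> :: real assume p: "asymptotically_subpower p" and "\<epsilon> > 0"
    then have e3: "\<epsilon>/3 > 0" by simp
    obtain g where g: "g \<in> higson_subpower x0" "\<And>x. x \<in> M \<Longrightarrow> \<bar>f x - g x\<bar> < \<epsilon>/3"
      using lim[OF e3] by auto
    obtain r where r: "r > 0" "\<And>x y z. x \<in> M \<Longrightarrow> d x x0 > r \<Longrightarrow> y \<in> mball x (p (d x x0)) \<Longrightarrow>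
       z \<in> mball x (p (d x x0)) \<Longrightarrow> \<bar>g y - g z\<bar> < \<epsilon>/3"
      using g(1)[unfolded higson_subpower_iff] p e3 by meson
    have "\<bar>f y - f z\<bar> < \<epsilon>" if x: "x \<in> M" "d x x0 > r"
      and yz: "y \<in> mball x (p (d x x0))" "z \<in> mball x (p (d x x0))" for x y z
      using r(2)[OF x yz] g(2)[of y] g(2)[of z] yz by (auto simp: abs_if split: if_splits)
    then show "\<exists>r0>0. \<forall>x\<in>M. d x x0 > r0 \<longrightarrow>
         (\<forall>y\<in>mball x (p (d x x0)). \<forall>z\<in>mball x (p (d x x0)). \<bar>f y - f z\<bar> < \<epsilon>)"
      using r(1) by blast
  qed (rule bc)
qed

lemma higson_subpower_separates:
  assumes x0: "x0 \<in> M" and C: "closedin mtopology C" and a: "a \<in> M - C"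
  shows "\<exists>f\<in>higson_subpower x0. f a \<notin> closure (f ` C)"
proof -
  have "openin mtopology (M - C)"
    using C by (metis openin_diff openin_topspace topspace_mtopology)
  then obtain r where r: "r > 0" "mball a r \<subseteq> M - C"
    using a by (auto simp: openin_mtopology)
  define f where "f y = max 0 (1 - d a y / r)" for y
  have lip: "\<bar>f y - f z\<bar> \<le> d y z / r" if "y \<in> M" "z \<in> M" for y z
  proof -
    have "\<bar>d a y - d a z\<bar> \<le> d y z"
      using a that by (smt (verit) DiffD1 commute triangle)
    then have "\<bar>d a y - d a z\<bar> / r \<le> d y z / r"
      using r by (simp add: divide_right_mono)
    moreover have "\<bar>f y - f z\<bar> \<le> \<bar>d a y / r - d a z / r\<bar>"
      unfolding f_def by linarith
    moreover have "\<bar>d a y / r - d a z / r\<bar> = \<bar>d a y - d a z\<bar> / r"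
      using r by (simp add: diff_divide_distrib[symmetric])
    ultimately show ?thesis by linarith
  qed
  have "continuous_map mtopology euclideanreal f"
  proof -
    have "\<exists>\<delta>>0. \<forall>y. y \<in> M \<and> d x y < \<delta> \<longrightarrow> \<bar>f x - f y\<bar> < \<epsilon>" if x: "x \<in> M" and e: "\<epsilon> > 0" for x \<epsilon>
    proof (intro exI conjI allI impI)
      show "\<epsilon> * r > 0" using e r by simp
      fix y assume "y \<in> M \<and> d x y < \<epsilon> * r"
      then show "\<bar>f x - f y\<bar> < \<epsilon>"
        using lip[OF x, of y] r by (smt (verit) pos_divide_less_eq)
    qed
    then show ?thesis
      using metric_continuous_map[OF Met_TC.Metric_space_axioms, of f]
      by (simp add: dist_real_def)
  qed
  moreover have f01: "0 \<le> f y" "f y \<le> 1" for y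
    using r by (auto simp: f_def)
  then have "bounded (f ` M)"
    by (auto simp: bounded_iff intro!: exI[of _ 1])
  ultimately have bc: "f \<in> bounded_continuous mtopology"
    by (simp add: bounded_continuous_def)
  have "f \<in> higson_subpower x0"
    unfolding higson_subpower_iff
  proof (intro conjI allI impI)
    fix p and \<epsilon> :: real assume p: "asymptotically_subpower p" and e: "\<epsilon> > 0"
    have "(1/2::real) > 0" by simp
    then obtain t0 where t0: "t0 > 0" "\<And>t. t > t0 \<Longrightarrow> p t < t powr (1/2)"
      using p unfolding asymptotically_subpower_def by blast
    define R where "R = max (max t0 4) (2 * (r + d a x0))"
    have "f y = 0" if x: "x \<in> M" "d x x0 > R" and y: "y \<in> mball x (p (d x x0))" for x y
    proof -
      have t: "d x x0 > t0" "d x x0 > 4" "d x x0 > 2 * (r + d a x0)"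
        using x(2) by (auto simp: R_def)
      have "sqrt 4 \<le> sqrt (d x x0)" using t(2) by (intro real_sqrt_le_mono) simp
      then have "2 * sqrt (d x x0) \<le> sqrt (d x x0) * sqrt (d x x0)"
        by (intro mult_right_mono) auto
      then have "sqrt (d x x0) \<le> d x x0 / 2" using t(2) by simp
      then have "p (d x x0) < d x x0 / 2"
        using t0(2)[OF t(1)] t(2) by (simp add: powr_half_sqrt)
      moreover have "d x x0 \<le> d x y + d a y + d a x0"
        using triangle[of x y x0] triangle[of y a x0] x y a x0 by (auto simp: commute)
      ultimately have "d a y > r"
        using y t(3) by auto
      then show ?thesis using r by (simp add: f_def field_simps)
    qed
    then show "\<exists>r0>0. \<forall>x\<in>M. d x x0 > r0 \<longrightarrow>
         (\<forall>y\<in>mball x (p (d x x0)). \<forall>z\<in>mball x (p (d x x0)). \<bar>f y - f z\<bar> < \<epsilon>)"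
      using e by (intro exI[of _ R]) (auto simp: R_def simp del: in_mball)
  qed (rule bc)
  moreover have "f a = 1"
    using a by (simp add: f_def)
  moreover have "f ` C \<subseteq> {0}"
  proof clarsimp
    fix y assume y: "y \<in> C"
    then have "y \<in> M" using closedin_subset[OF C] by auto
    then have "\<not> d a y < r" using r(2) y a by auto
    then show "f y = 0" using r by (simp add: f_def field_simps)
  qed
  then have "closure (f ` C) \<subseteq> {0}"
    using closure_mono[of "f ` C" "{0}"] by simp
  ultimately show ?thesis
    by (intro bexI[of _ f]) auto
qed

theorem is_compactification_higson:
  assumes "x0 \<in> M"
  shows "is_compactification mtopology (higson_compactification x0) (higson_embedding x0)"
  unfolding higson_compactification_def higson_embedding_def
proof (rule is_compactification_fun_compactification)
  show "higson_subpower x0 \<subseteq> bounded_continuous mtopology"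
    by (auto simp: higson_subpower_def)
qed (use assms higson_subpower_separates Hausdorff_space_mtopology in auto)

theorem extends_higson_compactification_iff:
  assumes "x0 \<in> M"
  shows "extends_continuously mtopology (higson_compactification x0) (higson_embedding x0) f
     \<longleftrightarrow> f \<in> higson_subpower x0"
  unfolding higson_compactification_def higson_embedding_def
proof (rule extends_fun_compactification_iff)
  show "higson_subpower x0 \<subseteq> bounded_continuous mtopology"
    by (auto simp: higson_subpower_def)
  show "compact_space (fun_compactification mtopology (higson_subpower x0))"
    using is_compactification_higson[OF assms]
    by (simp add: is_compactification_def higson_compactification_def)
  fix f
  assume "\<And>\<epsilon>. \<epsilon> > 0 \<Longrightarrow> \<exists>g\<in>higson_subpower x0. \<forall>x\<in>topspace mtopology. \<bar>f x - g x\<bar> < \<epsilon>"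
  then show "f \<in> higson_subpower x0"
    by (intro higson_subpower_closed) simp
qed (rule higson_subpower_const higson_subpower_add higson_subpower_mult; assumption)+

lemma proper_imp_locally_compact:
  assumes proper
  shows "locally_compact_space mtopology"
  unfolding locally_compact_space_def
proof
  fix x assume "x \<in> topspace mtopology"
  then have x: "x \<in> M" by simp
  have "closedin mtopology (mcball x 1)" "mbounded (mcball x 1)"
    by (auto simp: mbounded_def)
  then have "compactin mtopology (mcball x 1)"
    using assms by (simp add: proper_def)
  moreover have "mball x 1 \<subseteq> mcball x 1"
    by auto
  ultimately show "\<exists>U K. openin mtopology U \<and> compactin mtopology K \<and> x \<in> U \<and> U \<subseteq> K"
    using x by (intro exI[of _ "mball x 1"] exI[of _ "mcball x 1"]) auto
qed

theorem compact_Hausdorff_higson_corona: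
  assumes proper "x0 \<in> M"
  shows "compact_space (higson_corona x0)" "Hausdorff_space (higson_corona x0)"
proof -
  let ?K = "higson_compactification x0"
  have K: "compact_space ?K" "Hausdorff_space ?K" "embedding_map mtopology ?K (higson_embedding x0)"
      "?K closure_of (higson_embedding x0 ` M) = topspace ?K"
    using is_compactification_higson[OF assms(2)] by (auto simp: is_compactification_def)
  show "Hausdorff_space (higson_corona x0)"
    using K(2) by (simp add: higson_corona_def Hausdorff_space_subtopology)
  have "mtopology homeomorphic_space subtopology ?K (higson_embedding x0 ` M)"
    using embedding_map_imp_homeomorphic_space[OF K(3)] by simp
  then have "locally_compact_space (subtopology ?K (higson_embedding x0 ` M))"
    using proper_imp_locally_compact[OF assms(1)] homeomorphic_locally_compact_space by blast
  moreover have "higson_embedding x0 ` M \<subseteq> topspace ?K"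
    using K(3) K(4) fun_embedding_in_topspace[of _ mtopology "higson_subpower x0"]
    by (auto simp: higson_embedding_def higson_compactification_def)
  ultimately have "openin (subtopology ?K (?K closure_of (higson_embedding x0 ` M))) (higson_embedding x0 ` M)"
    using locally_compact_subspace_openin_closure_of[OF K(2)] by blast
  then have "openin ?K (higson_embedding x0 ` M)"
    by (simp add: K(4))
  then have "closedin ?K (topspace ?K - higson_embedding x0 ` M)"
    by blast
  then show "compact_space (higson_corona x0)"
    using K(1) unfolding higson_corona_def
    by (intro compact_space_subtopology closedin_compact_space)
qed

end

lemma is_compactification_closure:
  assumes "compact_space X" "Hausdorff_space X" "D \<subseteq> topspace X"
  shows "is_compactification (subtopology X D) (subtopology X (X closure_of D)) (\<lambda>y. y)"
  unfolding is_compactification_def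
proof (intro conjI)
  have D: "D \<subseteq> X closure_of D" "topspace (subtopology X D) = D"
    using assms(3) by (auto simp: closure_of_subset)
  show "compact_space (subtopology X (X closure_of D))"
    using assms(1) by (intro compact_space_subtopology closedin_compact_space) auto
  show "Hausdorff_space (subtopology X (X closure_of D))"
    using assms(2) by (rule Hausdorff_space_subtopology)
  show "embedding_map (subtopology X D) (subtopology X (X closure_of D)) (\<lambda>y. y)"
    using D homeomorphic_map_id[of "subtopology X D"]
    by (simp add: embedding_map_def subtopology_subtopology inf.absorb2 id_def)
  show "subtopology X (X closure_of D) closure_of ((\<lambda>y. y) ` topspace (subtopology X D)) =
      topspace (subtopology X (X closure_of D))"
    using D assms(3) closure_of_subset_topspace[of X D]
    by (simp add: closure_of_subtopology inf.absorb2)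
qed

end

(* The space consists of 0 and of pairs a i = 4^i, b i = a i + (a i) powr (1 / (m + 1)), where every
   label m = m i occurs for infinitely many i. For fixed m the gap is a fixed power of the norm, so
   the indicators of A_m = {a i | m i = m} and B_m = {b i | m i = m} are Higson subpower and cut out
   disjoint clopen sets A_m', B_m' of the corona. Their union D is sigma-compact, and the function
   that is 1 on all A_m' and 0 on all B_m' is continuous on D. An extension to the closure of D would
   extend further, by Tietze, to the whole compactification, and so come from a Higson subpower
   function F. For every m, F is close to 1 on almost all of A_m and close to 0 on almost all of B_m.
   Picking one far away pair of each label gives pairs whose gap is subpower, as the exponents
   1 / (m + 1) tend to 0, but on which F jumps by at least 1/3: a contradiction. *)

theory Submission
  imports Defs
begin

section \<open>Extension of functions and passage to closures\<close>

lemma continuous_map_indicator_clopen: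
  assumes "openin X (U \<inter> topspace X)" "openin X (topspace X - U)"
  shows "continuous_map X euclideanreal (indicator U)"
  unfolding continuous_map_def
proof (intro conjI allI impI)
  fix V :: "real set"
  have eq: "{x \<in> topspace X. indicator U x \<in> V} =
    (if 1 \<in> V then U \<inter> topspace X else {}) \<union> (if 0 \<in> V then topspace X - U else {})"
    by (auto simp: indicator_def split: if_splits)
  show "openin X {x \<in> topspace X. indicator U x \<in> V}"
    unfolding eq using assms by (intro openin_Un) auto
qed auto

text \<open>A bounded continuous \<open>g\<close> is a coordinate of the product that contains
  \<open>Stone_Cech X\<close>; that coordinate is carried to \<open>K\<close> by the inverse
  homeomorphism. This is the only property of the Stone-Cech compactification that the
  counterexample contradicts.\<close>

lemma equivalent_Stone_Cech_imp_extension: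
  assumes eq: "equivalent_compactifications X (Stone_Cech X) (Stone_Cech_embedding X) K e"
    and g: "g \<in> bounded_continuous X"
  shows "extends_continuously X K e g"
proof -
  obtain h where h: "homeomorphic_map (Stone_Cech X) K h"
      "\<And>x. x \<in> topspace X \<Longrightarrow> h (Stone_Cech_embedding X x) = e x"
    using eq by (auto simp: equivalent_compactifications_def)
  then obtain k where k: "homeomorphic_maps (Stone_Cech X) K h k"
    using homeomorphic_map_maps by blast
  obtain g' where g': "continuous_map (Stone_Cech X) euclideanreal g'"
      "\<And>x. x \<in> topspace X \<Longrightarrow> g' (Stone_Cech_embedding X x) = g x"
    using extends_fun_compactification[OF g, of X] by (auto simp: extends_continuously_def)
  show ?thesis
    unfolding extends_continuously_def
  proof (intro exI conjI ballI)
    show "continuous_map K euclideanreal (g' \<circ> k)"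
      using k g'(1) by (auto simp: homeomorphic_maps_def intro: continuous_map_compose)
    fix x assume x: "x \<in> topspace X"
    then have "k (h (Stone_Cech_embedding X x)) = Stone_Cech_embedding X x"
      using k fun_embedding_in_topspace[OF x] by (auto simp: homeomorphic_maps_def)
    then show "(g' \<circ> k) (e x) = g x"
      using h(2)[OF x] g'(2)[OF x] by simp
  qed
qed

text \<open>A continuous map sends a closure into the closure of the image. This carries closed
  conditions checked at points of the space over to points of the corona.\<close>

lemma continuous_map_closure_of_in_closed:
  fixes u :: "'a \<Rightarrow> 'b::topological_space"
  assumes u: "continuous_map K euclidean u" and "closed C" "u ` S \<subseteq> C"
    and y: "y \<in> K closure_of S"
  shows "u y \<in> C"
proof -
  have "u y \<in> euclidean closure_of (u ` S)"
    using continuous_map_image_closure_subset[OF u, of S] y by blast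
  also have "\<dots> \<subseteq> C"
    using assms by (intro closure_of_minimal) auto
  finally show ?thesis .
qed

lemma eventually_powr_less_powr:
  assumes "c > 0" "\<beta> < (\<alpha>::real)"
  shows "\<forall>\<^sub>F t in at_top. t powr \<beta> < c * t powr \<alpha>"
proof -
  have "((\<lambda>t::real. t powr (\<beta> - \<alpha>)) \<longlongrightarrow> 0) at_top"
    using assms by (intro tendsto_neg_powr filterlim_ident) auto
  then have "\<forall>\<^sub>F t::real in at_top. t powr (\<beta> - \<alpha>) < c"
    using assms(1) by (rule order_tendstoD)
  then show ?thesis
    using eventually_gt_at_top[of 0]
    by eventually_elim (simp add: powr_diff field_simps)
qed

section \<open>Corona points and tests for Higson subpower functions\<close>

context Metric_space
begin

lemma continuous_map_higson_projection:
  assumes "f \<in> higson_subpower x0"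
  shows "continuous_map (higson_compactification x0) euclideanreal (\<lambda>y. y f)"
  unfolding higson_compactification_def fun_compactification_def
  by (intro continuous_map_from_subtopology continuous_map_product_projection assms)

text \<open>Otherwise the closure of the image of \<open>S\<close>, being compact, would lie inside
  the embedded copy of the space, and its preimage would be a compact, hence bounded, set containing
  \<open>S\<close>.\<close>

lemma unbounded_closure_meets_corona:
  assumes "x0 \<in> M" "S \<subseteq> M" "\<not> mbounded S"
  shows "\<exists>y\<in>topspace (higson_corona x0). y \<in> higson_compactification x0 closure_of (higson_embedding x0 ` S)"
proof (rule ccontr)
  let ?K = "higson_compactification x0" and ?e = "higson_embedding x0"
  let ?C = "?K closure_of (?e ` S)"
  assume "\<not> ?thesis"
  then have sub: "?C \<subseteq> ?e ` M"
    using closure_of_subset_topspace[of ?K "?e ` S"] by (auto simp: higson_corona_def)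
  have K: "compact_space ?K" "embedding_map mtopology ?K ?e"
    using is_compactification_higson[OF assms(1)] by (auto simp: is_compactification_def)
  have hm: "homeomorphic_map mtopology (subtopology ?K (?e ` M)) ?e"
    using K(2) by (simp add: embedding_map_def)
  then obtain k where k: "homeomorphic_maps mtopology (subtopology ?K (?e ` M)) ?e k"
    using homeomorphic_map_maps by blast
  have "compactin ?K ?C"
    using K(1) by (intro closedin_compact_space) auto
  then have "compactin (subtopology ?K (?e ` M)) ?C"
    using sub by (simp add: compactin_subtopology)
  then have "compactin mtopology (k ` ?C)"
    using k by (auto simp: homeomorphic_maps_def intro: image_compactin)
  then have "mbounded (k ` ?C)"
    by (rule compactin_imp_mbounded)
  moreover have "S \<subseteq> k ` ?C"
  proof
    fix x assume x: "x \<in> S"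
    then have "?e ` S \<subseteq> topspace ?K"
      using assms(2) fun_embedding_in_topspace[of _ mtopology]
      by (auto simp: higson_compactification_def higson_embedding_def)
    then have "?e x \<in> ?C"
      using x closure_of_subset by blast
    moreover have "k (?e x) = x"
      using k x assms(2) by (auto simp: homeomorphic_maps_def)
    ultimately show "x \<in> k ` ?C" by force
  qed
  ultimately show False
    using assms(3) mbounded_subset by blast
qed

text \<open>Far from the basepoint a ball of subpower radius is too small to bridge a gap that grows
  like a fixed power of the norm, so the indicator is constant on it.\<close>

lemma indicator_higson_subpower:
  assumes x0: "x0 \<in> M" and S: "openin mtopology S" "openin mtopology (M - S)"
    and "c > 0" "\<alpha> > 0"
    and sep: "\<And>x y. x \<in> S \<Longrightarrow> y \<in> M - S \<Longrightarrow> c * d x x0 powr \<alpha> \<le> d x y"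
  shows "indicator S \<in> higson_subpower x0"
  unfolding higson_subpower_iff
proof (intro conjI allI impI)
  have "S \<subseteq> M" using openin_subset[OF S(1)] by simp
  then have "continuous_map mtopology euclideanreal (indicator S)"
    using S by (intro continuous_map_indicator_clopen) (auto simp: Int_absorb2)
  moreover have "bounded ((indicator S :: _ \<Rightarrow> real) ` M)"
    by (auto simp: bounded_iff indicator_def intro!: exI[of _ 1])
  ultimately show "indicator S \<in> bounded_continuous mtopology"
    by (simp add: bounded_continuous_def)
  fix p and \<epsilon> :: real assume p: "asymptotically_subpower p" and "\<epsilon> > 0"
  \<comment> \<open>With \<open>\<beta> < 1\<close> the points of the ball around \<open>x\<close>
    keep at least half the norm of \<open>x\<close>; with \<open>\<beta> < \<alpha>\<close> twice
    the radius stays below \<open>c * (t / 2) powr \<alpha>\<close>, the least possible gap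
    there.\<close>
  define \<beta> where "\<beta> = min \<alpha> 1 / 2"
  have \<beta>: "0 < \<beta>" "\<beta> < \<alpha>" "\<beta> < 1"
    using \<open>\<alpha> > 0\<close> by (auto simp: \<beta>_def min_def)
  obtain t0 where t0: "\<And>t. t > t0 \<Longrightarrow> p t < t powr \<beta>"
    using p \<beta> unfolding asymptotically_subpower_def by blast
  have "\<forall>\<^sub>F t in at_top. t > t0 \<and> t > 0 \<and> t powr \<beta> < 1/2 * t powr 1 \<and>
      t powr \<beta> < c / (2 * 2 powr \<alpha>) * t powr \<alpha>"
    using \<beta> \<open>c > 0\<close>
    by (intro eventually_conj eventually_gt_at_top eventually_powr_less_powr) auto
  then obtain R where R: "\<And>t. t \<ge> R \<Longrightarrow> t > t0 \<and> t > 0 \<and> t powr \<beta> < 1/2 * t powr 1 \<and>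
      t powr \<beta> < c / (2 * 2 powr \<alpha>) * t powr \<alpha>"
    unfolding eventually_at_top_linorder by blast
  have *: False if x: "x \<in> M" "d x x0 > R" and y: "y \<in> mball x (p (d x x0))" "y \<in> S"
    and z: "z \<in> mball x (p (d x x0))" "z \<notin> S" for x y z
  proof -
    define t where "t = d x x0"
    have t: "t > 0" "p t < t powr \<beta>" "p t < t / 2" "p t < c / (2 * 2 powr \<alpha>) * t powr \<alpha>"
      using R[of t] t0[of t] x(2) by (auto simp: t_def)
    have "t \<le> d x y + d y x0" "d y z \<le> d x y + d x z"
      using triangle[of x y x0] triangle[of y x z] x y z x0 by (auto simp: t_def commute)
    then have dy: "t / 2 \<le> d y x0" "d y z < 2 * p t"
      using y z t(3) by (auto simp: t_def)
    have "c * (t / 2) powr \<alpha> \<le> c * d y x0 powr \<alpha>"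
      using dy t \<open>c > 0\<close> \<open>\<alpha> > 0\<close> by (intro mult_left_mono powr_mono2) auto
    also have "\<dots> \<le> d y z"
      using sep[of y z] y z by auto
    also have "\<dots> < 2 * p t"
      by (rule dy(2))
    finally have "c / 2 powr \<alpha> * t powr \<alpha> < 2 * p t"
      using t(1) by (simp add: powr_divide)
    then show False
      using t(4) by (simp add: field_simps)
  qed
  have "\<bar>indicator S y - indicator S z\<bar> < \<epsilon>"
    if "x \<in> M" "d x x0 > max R 1" "y \<in> mball x (p (d x x0))" "z \<in> mball x (p (d x x0))" for x y z
    using *[of x y z] *[of x z y] that \<open>\<epsilon> > 0\<close> by (auto simp: indicator_def)
  then show "\<exists>r0>0. \<forall>x\<in>M. d x x0 > r0 \<longrightarrow> (\<forall>y\<in>mball x (p (d x x0)).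
      \<forall>z\<in>mball x (p (d x x0)). \<bar>indicator S y - indicator S z\<bar> < \<epsilon>)"
    by (intro exI[of _ "max R 1"]) auto
qed

text \<open>A single asymptotically subpower \<open>p\<close> has every \<open>y n\<close> in its
  ball around \<open>x n\<close>, since the exponents \<open>1 / (n + 1)\<close> tend to 0. The
  Higson condition for this \<open>p\<close> then applies to any pair far enough out.\<close>

lemma higson_subpower_close_pair:
  assumes f: "f \<in> higson_subpower x0" and xy: "\<And>n. x n \<in> M" "\<And>n. y n \<in> M" 
    and mono: "strict_mono (\<lambda>n. d (x n) x0)" and ge: "\<And>n. real n < d (x n) x0"
    and close: "\<And>n. d (x n) (y n) \<le> d (x n) x0 powr (1 / (real n + 1))" and "\<epsilon> > 0"
  shows "\<exists>n. \<bar>f (x n) - f (y n)\<bar> < \<epsilon>"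
proof -
  define T where "T n = d (x n) x0" for n
  have injT: "inj T"
    using mono unfolding T_def by (rule strict_mono_imp_inj_on)
  \<comment> \<open>Strict growth of the norms lets \<open>inv T\<close> recover the index from the
    norm. The factor 2 turns the bound \<open>\<le>\<close> on the distance into the strict one of
    an open ball; away from the norms of the \<open>x n\<close> the value 0 is harmless.\<close>
  define p where "p t = (if t \<in> range T then 2 * t powr (1 / (real (inv T t) + 1)) else 0)" for t
  have pT: "p (T n) = 2 * T n powr (1 / (real n + 1))" for n
    using injT by (simp add: p_def)
  have "asymptotically_subpower p"
    unfolding asymptotically_subpower_def
  proof (intro conjI allI impI)
    fix \<alpha> :: real assume "\<alpha> > 0"
    then obtain n where n: "1 / (real n + 1) < \<alpha>"
      by (metis nat_approx_posE of_nat_Suc add.commute)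
    \<comment> \<open>Beyond \<open>T n\<close> only indices \<open>m > n\<close> occur, and for
      \<open>t > 1\<close> their smaller exponents give smaller powers. The 1/2 absorbs the factor 2
      in \<open>p\<close>.\<close>
    have "\<forall>\<^sub>F t in at_top. t > 1 \<and> t > T n \<and> t powr (1 / (real n + 1)) < 1/2 * t powr \<alpha>"
      using n by (intro eventually_conj eventually_gt_at_top eventually_powr_less_powr) auto
    then obtain t0 where t0: "\<And>t. t \<ge> t0 \<Longrightarrow> t > 1 \<and> t > T n \<and> t powr (1 / (real n + 1)) < 1/2 * t powr \<alpha>"
      unfolding eventually_at_top_linorder by blast
    have "p t < t powr \<alpha>" if "t > t0" for t
    proof (cases "t \<in> range T")
      case True
      then obtain m where m: "t = T m" by auto
      then have "m > n"
        using t0[of t] that strict_mono_less[OF mono, of n m] by (simp add: T_def)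
      then have "2 * t powr (1 / (real m + 1)) \<le> 2 * t powr (1 / (real n + 1))"
        using t0[of t] that by (intro mult_left_mono powr_mono divide_left_mono) auto
      also have "\<dots> < t powr \<alpha>"
        using t0[of t] that by simp
      finally show ?thesis
        by (simp add: m pT)
    next
      case False
      then show ?thesis using t0[of t] that by (simp add: p_def)
    qed
    then show "\<exists>t0>0. \<forall>t>t0. p t < t powr \<alpha>"
      by (intro exI[of _ "max t0 1"]) auto
  qed (auto simp: p_def)
  then obtain r where r: "\<And>z v w. z \<in> M \<Longrightarrow> d z x0 > r \<Longrightarrow> v \<in> mball z (p (d z x0)) \<Longrightarrow>
       w \<in> mball z (p (d z x0)) \<Longrightarrow> \<bar>f v - f w\<bar> < \<epsilon>"
    using f \<open>\<epsilon> > 0\<close> unfolding higson_subpower_iff by meson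
  obtain n where "real n > r" using reals_Archimedean2 by blast
  then have n: "T n > r" "T n > 0" using ge[of n] by (auto simp: T_def)
  then have "T n powr (1 / (real n + 1)) > 0" by simp
  then have "d (x n) (y n) < p (T n)" "0 < p (T n)"
    using close[of n] unfolding pT unfolding T_def by linarith+
  then show ?thesis
    using r[of "x n" "x n" "y n"] n xy by (auto simp: T_def)
qed

section \<open>The counterexample for an abstract sequence of labelled pairs\<close>

theorem not_equivalent_Stone_Cech:
  fixes a b :: "nat \<Rightarrow> 'a" and l :: "nat \<Rightarrow> nat"
  assumes "proper" and x0: "x0 \<in> M" and ab: "range a \<subseteq> M" "range b \<subseteq> M"
    and disj: "range a \<inter> range b = {}"
    and lim: "filterlim (\<lambda>i. d (a i) x0) at_top sequentially"
    and limb: "filterlim (\<lambda>i. d (b i) x0) at_top sequentially"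
    and close: "\<And>i. d (a i) (b i) \<le> d (a i) x0 powr (1 / (real (l i) + 1))"
    and inf: "\<And>m. infinite {i. l i = m}"
    and indA: "\<And>m. indicator (a ` {i. l i = m}) \<in> higson_subpower x0"
    and indB: "\<And>m. indicator (b ` {i. l i = m}) \<in> higson_subpower x0"
  defines "\<nu> \<equiv> higson_corona x0"
  shows "\<exists>D \<subseteq> topspace \<nu>. sigma_compactin \<nu> D \<and>
        \<not> equivalent_compactifications (subtopology \<nu> D)
            (Stone_Cech (subtopology \<nu> D)) (Stone_Cech_embedding (subtopology \<nu> D))
            (subtopology \<nu> (\<nu> closure_of D)) (\<lambda>y. y)"
proof -
  let ?K = "higson_compactification x0" and ?e = "higson_embedding x0"
  have K: "compact_space ?K" "Hausdorff_space ?K" "?K closure_of (?e ` M) = topspace ?K"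
    using is_compactification_higson[OF x0] by (auto simp: is_compactification_def)
  have \<nu>: "compact_space \<nu>" "topspace \<nu> \<subseteq> topspace ?K" "\<nu> = subtopology ?K (topspace \<nu>)"
    using compact_Hausdorff_higson_corona[OF assms(1) x0]
    by (auto simp: \<nu>_def higson_corona_def inf.absorb2)
  have e: "?e x f = f x" if "f \<in> higson_subpower x0" for x f
    using that by (simp add: higson_embedding_def fun_embedding_apply)
  define cl :: "'a set \<Rightarrow> (('a \<Rightarrow> real) \<Rightarrow> real) set"
    where "cl S = {y \<in> topspace \<nu>. y (indicator S) = 1}" for S
  have cl: "closedin \<nu> (cl S)" "openin \<nu> (cl S)" if S: "indicator S \<in> higson_subpower x0" for S
  proof -
    have c: "continuous_map \<nu> euclideanreal (\<lambda>y. y (indicator S))"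
      using continuous_map_higson_projection[OF S] \<nu>(3) continuous_map_from_subtopology by metis
    \<comment> \<open>The coordinate takes only the values 0 and 1 on the dense image of the space,
      hence everywhere. So being 1 is the same as exceeding 1/2: a condition both closed and
      open.\<close>
    have "y (indicator S) \<in> {0, 1}" if "y \<in> topspace \<nu>" for y
      using that \<nu>(2) S K(3)
      by (intro continuous_map_closure_of_in_closed[OF continuous_map_higson_projection[OF S],
            where S = "?e ` M"]) (auto simp: e indicator_def)
    then have "cl S = {y \<in> topspace \<nu>. y (indicator S) \<in> {1}}"
      "cl S = {y \<in> topspace \<nu>. y (indicator S) \<in> {1/2<..}}"
      by (fastforce simp: cl_def)+
    then show "closedin \<nu> (cl S)" "openin \<nu> (cl S)"
      using closedin_continuous_map_preimage[OF c, of "{1}"]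
        openin_continuous_map_preimage[OF c, of "{1/2<..}"] by auto
  qed
  have cl_disj: "cl S \<inter> cl T = {}"
    if S: "indicator S \<in> higson_subpower x0" and T: "indicator T \<in> higson_subpower x0"
      and "S \<inter> T = {}" for S T
  proof -
    \<comment> \<open>The sum is at most 1 on the dense image because \<open>S\<close> and
      \<open>T\<close> are disjoint, so the two coordinates are never both 1.\<close>
    have "y (indicator S) + y (indicator T) \<in> {..1}" if "y \<in> topspace \<nu>" for y
      using that \<nu>(2) S T K(3) \<open>S \<inter> T = {}\<close>
      by (intro continuous_map_closure_of_in_closed[where S = "?e ` M" and K = ?K
            and u = "\<lambda>y. y (indicator S) + y (indicator T)"]
          continuous_map_add continuous_map_higson_projection) (auto simp: e indicator_def)
    then show ?thesis by (fastforce simp: cl_def)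
  qed
  define A where "A m = a ` {i. l i = m}" for m
  define B where "B m = b ` {i. l i = m}" for m
  have AB: "indicator (A m) \<in> higson_subpower x0" "indicator (B m) \<in> higson_subpower x0" for m
    using indA indB by (auto simp: A_def B_def)
  have AB_disj: "A m \<inter> B n = {}" for m n
    using disj by (auto simp: A_def B_def)
  define DA where "DA = (\<Union>m. cl (A m))"
  define DB where "DB = (\<Union>m. cl (B m))"
  define D where "D = DA \<union> DB"
  have DAB: "DA \<inter> DB = {}"
    using cl_disj[OF AB AB_disj] by (auto simp: DA_def DB_def)
  have D_sub: "D \<subseteq> topspace \<nu>"
    by (auto simp: D_def DA_def DB_def cl_def)
  have "sigma_compactin \<nu> D"
    unfolding sigma_compactin_def
  proof (intro exI conjI allI)
    show "compactin \<nu> (cl (A n) \<union> cl (B n))" for n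
      using \<nu>(1) cl AB by (intro closedin_compact_space closedin_Un) auto
    show "D = (\<Union>n. cl (A n) \<union> cl (B n))"
      by (auto simp: D_def DA_def DB_def)
  qed
  moreover have "\<not> equivalent_compactifications (subtopology \<nu> D)
            (Stone_Cech (subtopology \<nu> D)) (Stone_Cech_embedding (subtopology \<nu> D))
            (subtopology \<nu> (\<nu> closure_of D)) (\<lambda>y. y)"
  proof
    assume eq: "equivalent_compactifications (subtopology \<nu> D)
            (Stone_Cech (subtopology \<nu> D)) (Stone_Cech_embedding (subtopology \<nu> D))
            (subtopology \<nu> (\<nu> closure_of D)) (\<lambda>y. y)"
    \<comment> \<open>Infinite unions of clopen sets are still open. Since \<open>DA\<close> and
      \<open>DB\<close> are complementary in \<open>D\<close>, this makes \<open>DA\<close> clopen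
      relative to \<open>D\<close>.\<close>
    have op: "openin \<nu> DA" "openin \<nu> DB"
      using cl AB by (auto simp: DA_def DB_def)
    have top: "topspace (subtopology \<nu> D) = D" using D_sub by auto
    have "continuous_map (subtopology \<nu> D) euclideanreal (indicator DA)"
    proof (rule continuous_map_indicator_clopen)
      show "openin (subtopology \<nu> D) (DA \<inter> topspace (subtopology \<nu> D))"
        unfolding top using op by (auto simp: openin_subtopology)
      have "D - DA = DB \<inter> D" using DAB by (auto simp: D_def)
      then show "openin (subtopology \<nu> D) (topspace (subtopology \<nu> D) - DA)"
        unfolding top using op by (auto simp: openin_subtopology)
    qed
    moreover have "bounded ((indicator DA :: _ \<Rightarrow> real) ` D)"
      by (auto simp: bounded_iff indicator_def intro!: exI[of _ 1])
    ultimately have "indicator DA \<in> bounded_continuous (subtopology \<nu> D)"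
      using top by (simp add: bounded_continuous_def del: topspace_subtopology)
    then obtain g where g: "continuous_map (subtopology \<nu> (\<nu> closure_of D)) euclideanreal g"
        "\<And>y. y \<in> D \<Longrightarrow> g y = indicator DA y"
      using equivalent_Stone_Cech_imp_extension[OF eq] unfolding extends_continuously_def top by blast
    have sub: "\<nu> closure_of D \<subseteq> topspace \<nu>"
      by (rule closure_of_subset_topspace)
    \<comment> \<open>Tietze is to be applied in the whole compactification, so that the extension
      also has values at points of the space. The closure taken in the corona is closed there
      because it is compact.\<close>
    have comp: "compactin \<nu> (\<nu> closure_of D)"
      using \<nu>(1) by (intro closedin_compact_space) auto
    then have "compactin ?K (\<nu> closure_of D)"
      using \<nu>(3) by (metis compactin_subtopology)
    then have clo: "closedin ?K (\<nu> closure_of D)"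
      using K(2) compactin_imp_closedin by blast
    have "subtopology \<nu> (\<nu> closure_of D) = subtopology ?K (\<nu> closure_of D)"
      using \<nu>(3) sub by (metis subtopology_subtopology inf.absorb2)
    then have gK: "continuous_map (subtopology ?K (\<nu> closure_of D)) euclideanreal g"
      using g(1) by simp
    have "normal_space ?K"
      using K by (simp add: compact_Hausdorff_or_regular_imp_normal_space)
    then obtain G where G: "continuous_map ?K euclideanreal G"
        "\<And>y. y \<in> \<nu> closure_of D \<Longrightarrow> G y = g y"
      using Tietze_extension_realinterval[of ?K "\<nu> closure_of D" UNIV g] clo gK 
      by auto
    have GD: "G y = indicator DA y" if "y \<in> D" for y
      using that G(2) g(2) D_sub closure_of_subset[of D \<nu>] by auto
    \<comment> \<open>\<open>F\<close> extends to the compactification by construction, and exactly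
      the Higson subpower functions do so.\<close>
    define F where "F = G \<circ> ?e"
    have "extends_continuously mtopology ?K ?e F"
      using G(1) by (auto simp: extends_continuously_def F_def)
    then have F: "F \<in> higson_subpower x0"
      using extends_higson_compactification_iff[OF x0] by blast
    have unb: "\<not> mbounded (c ` J)"
      if J: "infinite J" and c: "filterlim (\<lambda>i. d (c i) x0) at_top sequentially" for c and J :: "nat set"
    proof
      assume "mbounded (c ` J)"
      then obtain y B where B: "c ` J \<subseteq> mcball y B"
        unfolding mbounded_def by blast
      have "\<forall>\<^sub>F i in sequentially. d (c i) x0 > B + d y x0"
        using c by (auto simp: filterlim_at_top_dense)
      then obtain N where "\<And>i. i \<ge> N \<Longrightarrow> d (c i) x0 > B + d y x0"
        by (auto simp: eventually_sequentially)
      moreover obtain i where "i \<in> J" "i \<ge> N"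
        using J by (auto simp: infinite_nat_iff_unbounded_le)
      moreover from \<open>i \<in> J\<close> have "c i \<in> mcball y B" using B by blast
      ultimately show False
        using triangle[of "c i" y x0] x0 by (force simp: commute)
    qed
    \<comment> \<open>Infinitely many such points would be unbounded and accumulate at some
      \<open>y\<close> in the corona. Its indicator coordinate is 1, so it lies in the
      \<open>cl\<close> set of label \<open>m\<close>, while closedness of \<open>C\<close> forces
      \<open>G y \<in> C\<close>. This is applied to the \<open>a i\<close> with
      \<open>{..2/3}\<close>, as \<open>G\<close> is 1 on \<open>DA\<close>, and to the
      \<open>b i\<close> with \<open>{1/3..}\<close>, as \<open>G\<close> is 0 on
      \<open>DB\<close>.\<close>
    have fin: "finite {i. l i = m \<and> c (i::nat) \<in> {x. G (?e x) \<in> C}}"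
      if c: "range c \<subseteq> M" "\<And>J. infinite J \<Longrightarrow> \<not> mbounded (c ` J)"
        and ind: "indicator (c ` {i. l i = m}) \<in> higson_subpower x0"
        and "closed C" and GC: "\<And>y. y \<in> cl (c ` {i. l i = m}) \<Longrightarrow> G y \<notin> C" for c m C
    proof (rule ccontr)
      let ?J = "{i. l i = m \<and> c (i::nat) \<in> {x. G (?e x) \<in> C}}"
      assume "infinite ?J"
      then have "\<not> mbounded (c ` ?J)" by (rule c(2))
      then obtain y where y: "y \<in> topspace \<nu>" "y \<in> ?K closure_of (?e ` c ` ?J)"
        using unbounded_closure_meets_corona[OF x0, of "c ` ?J"] c(1) by (auto simp: \<nu>_def)
      have "y (indicator (c ` {i. l i = m})) \<in> {1}"
        using ind by (intro continuous_map_closure_of_in_closed[OF continuous_map_higson_projection[OF ind] _ _ y(2)])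
          (auto simp: e)
      moreover have "G y \<in> C"
        using \<open>closed C\<close> by (intro continuous_map_closure_of_in_closed[OF G(1) _ _ y(2)]) auto
      ultimately show False
        using GC[of y] y(1) by (auto simp: cl_def)
    qed
    have finA: "finite {i. l i = m \<and> a i \<in> {x. G (?e x) \<in> {..2/3}}}" for m
    proof (rule fin)
      fix y assume "y \<in> cl (a ` {i. l i = m})"
      then have "y \<in> DA" by (auto simp: DA_def A_def)
      then show "G y \<notin> {..2/3}" using GD[of y] by (simp add: D_def)
    qed (use ab unb lim indA in auto)
    have finB: "finite {i. l i = m \<and> b i \<in> {x. G (?e x) \<in> {1/3..}}}" for m
    proof (rule fin)
      fix y assume "y \<in> cl (b ` {i. l i = m})"
      then have "y \<in> DB" by (auto simp: DB_def B_def)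
      then show "G y \<notin> {1/3..}" using GD[of y] DAB by (auto simp: D_def indicator_def)
    qed (use ab unb limb indB in auto)
    have ex: "\<exists>i. l i = m \<and> F (a i) > 2/3 \<and> F (b i) < 1/3 \<and> d (a i) x0 > t" for m t
    proof -
      have "\<forall>\<^sub>F i in sequentially. d (a i) x0 > t"
        using lim by (auto simp: filterlim_at_top_dense)
      then have "finite {i. \<not> d (a i) x0 > t}"
        by (simp add: eventually_cofinite flip: cofinite_eq_sequentially)
      then have "finite ({i. \<not> d (a i) x0 > t} \<union> {i. l i = m \<and> a i \<in> {x. G (?e x) \<in> {..2/3}}} \<union>
          {i. l i = m \<and> b i \<in> {x. G (?e x) \<in> {1/3..}}})" (is "finite ?N")
        using finA finB by blast
      then have "infinite ({i. l i = m} - ?N)"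
        by (rule Diff_infinite_finite) (rule inf)
      then obtain i where "i \<in> {i. l i = m} - ?N"
        using infinite_imp_nonempty by blast
      then show ?thesis by (auto simp: F_def intro!: exI[of _ i])
    qed
    define P where "P m i \<longleftrightarrow> l i = m \<and> F (a i) > 2/3 \<and> F (b i) < 1/3 \<and> d (a i) x0 > real m" for m i
    \<comment> \<open>The \<open>m\<close>-th pair has label \<open>m\<close>, hence gap exponent at
      most \<open>1 / (m + 1)\<close>, and is taken farther out than its predecessor, as
      \<open>higson_subpower_close_pair\<close> requires.\<close>
    have "\<exists>i. \<forall>m. P m (i m) \<and> d (a (i m)) x0 < d (a (i (Suc m))) x0"
    proof (rule dependent_nat_choice)
      show "\<exists>i. P 0 i" using ex[of 0 0] by (auto simp: P_def)
      show "\<exists>j. P (Suc m) j \<and> d (a i) x0 < d (a j) x0" for i m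
        using ex[of "Suc m" "max (real (Suc m)) (d (a i) x0)"] by (auto simp: P_def)
    qed
    then obtain i where i: "\<And>m. P m (i m)" "\<And>m. d (a (i m)) x0 < d (a (i (Suc m))) x0"
      by blast
    have "\<exists>m. \<bar>F (a (i m)) - F (b (i m))\<bar> < 1/3"
    proof (rule higson_subpower_close_pair[OF F])
      show "strict_mono (\<lambda>m. d (a (i m)) x0)"
        using i(2) by (simp add: strict_mono_Suc_iff)
      show "d (a (i m)) (b (i m)) \<le> d (a (i m)) x0 powr (1 / (real m + 1))" for m
        using close[of "i m"] i(1)[of m] by (simp add: P_def)
    qed (use i(1) ab in \<open>auto simp: P_def\<close>)
    then obtain m where "\<bar>F (a (i m)) - F (b (i m))\<bar> < 1/3" ..
    moreover have "F (a (i m)) > 2/3" "F (b (i m)) < 1/3"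
      using i(1)[of m] by (auto simp: P_def)
    ultimately show False by linarith
  qed
  ultimately show ?thesis
    using D_sub by blast
qed

end

section \<open>The concrete space on the real line\<close>

text \<open>The label of a pair is the first component of its decoded index, so each label recurs
  infinitely often.\<close>

definition spread_pair_gap :: "nat \<Rightarrow> real" where
  "spread_pair_gap i = (4 ^ i) powr (1 / (real (fst (prod_decode i)) + 1))"

text \<open>With basepoint 0 the norm of a point is its value. The base 4 leaves room between pairs:
  the \<open>i\<close>-th pair lies in \<open>[4^i, 2 * 4^i]\<close>.\<close>

definition spread_pairs :: "real set" where
  "spread_pairs = insert 0 (range (\<lambda>i. 4 ^ i) \<union> range (\<lambda>i. 4 ^ i + spread_pair_gap i))"

lemma spread_pair_gap_bounds: "1 \<le> spread_pair_gap i" "spread_pair_gap i \<le> 4 ^ i"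
proof -
  have "spread_pair_gap i \<le> (4 ^ i) powr 1"
    unfolding spread_pair_gap_def by (intro powr_mono) (auto simp: field_simps)
  then show "spread_pair_gap i \<le> 4 ^ i" by simp
  show "1 \<le> spread_pair_gap i"
    unfolding spread_pair_gap_def by (intro ge_one_powr_ge_zero) auto
qed

lemma of_nat_less_power_4: "real i < 4 ^ i"
proof (induction i)
  case (Suc i)
  moreover have "(1::real) \<le> 4 ^ i" by simp
  ultimately show ?case unfolding of_nat_Suc power_Suc by linarith
qed simp

text \<open>The partner is at distance exactly the gap. Earlier points are at most
  \<open>4^i / 2\<close>, later ones at least \<open>4 * 4^i\<close>, and the gap is at most
  \<open>4^i\<close>; the earlier points account for the factor 1/2.\<close>

lemma spread_pairs_separated:
  assumes x: "x \<in> {4 ^ i, 4 ^ i + spread_pair_gap i}" and y: "y \<in> spread_pairs" "y \<noteq> x"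
  shows "spread_pair_gap i / 2 \<le> dist x y"
proof -
  define u where "u = (4::real) ^ i"
  define g where "g = spread_pair_gap i"
  have u: "x = u \<or> x = u + g" "1 \<le> g" "g \<le> u"
    using x spread_pair_gap_bounds[of i] by (auto simp: u_def g_def)
  have "g / 2 \<le> dist x y"
  proof (cases "y = 0")
    case True
    then show ?thesis using u by (auto simp: dist_real_def)
  next
    case False
    with y obtain j where j: "y \<in> {4 ^ j, 4 ^ j + spread_pair_gap j}"
      by (auto simp: spread_pairs_def)
    define v where "v = (4::real) ^ j"
    define h where "h = spread_pair_gap j"
    have v: "y = v \<or> y = v + h" "1 \<le> h" "h \<le> v"
      using j spread_pair_gap_bounds[of j] by (auto simp: v_def h_def)
    have "4 * v \<le> u" if "j < i"
      using power_increasing[of "Suc j" i "4::real"] that by (simp add: u_def v_def)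
    moreover have "4 * u \<le> v" if "i < j"
      using power_increasing[of "Suc i" j "4::real"] that by (simp add: u_def v_def)
    moreover have "u = v \<and> g = h" if "i = j"
      using that by (simp add: u_def v_def g_def h_def)
    ultimately have "4 * v \<le> u \<or> 4 * u \<le> v \<or> u = v \<and> g = h"
      using nat_neq_iff by blast
    then show ?thesis
      using u v y(2) unfolding dist_real_def by - (elim disjE conjE; linarith)
  qed
  then show ?thesis by (simp add: g_def)
qed

interpretation spread: Metric_space spread_pairs "dist :: real \<Rightarrow> real \<Rightarrow> real"
  by unfold_locales (auto simp: dist_commute dist_triangle)

text \<open>Of two distinct points at least one is nonzero; its gap is at least 1, so the points are
  at least 1/2 apart and the space is discrete.\<close>

lemma openin_spread_pairs:
  assumes "S \<subseteq> spread_pairs"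
  shows "openin spread.mtopology S"
  unfolding spread.openin_mtopology
proof (intro conjI allI impI assms)
  fix x assume "x \<in> S"
  with assms have x: "x \<in> spread_pairs" by auto
  have "y = x" if y: "y \<in> spread_pairs" "dist x y < 1 / 2" for y
  proof (rule ccontr)
    assume "y \<noteq> x"
    have *: "v = 0 \<or> 1 / 2 \<le> dist v w" if "v \<in> spread_pairs" "w \<in> spread_pairs" "v \<noteq> w" for v w
    proof (cases "v = 0")
      case False
      with that obtain i where "v \<in> {4 ^ i, 4 ^ i + spread_pair_gap i}"
        by (auto simp: spread_pairs_def)
      then show ?thesis
        using spread_pairs_separated[of v i w] spread_pair_gap_bounds(1)[of i] that by auto
    qed simp
    show False
      using *[of x y] *[of y x] x y \<open>y \<noteq> x\<close> by (auto simp: dist_commute)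
  qed
  then have "spread.mball x (1/2) \<subseteq> {x}"
    by (auto simp del: divide_const_simps less_divide_eq_numeral1)
  then show "\<exists>r>0. spread.mball x r \<subseteq> S"
    using \<open>x \<in> S\<close> by (intro exI[of _ "1/2"]) auto
qed

lemma finite_bounded_spread_pairs: "finite {x \<in> spread_pairs. dist x z \<le> r}"
proof -
  obtain n :: nat where n: "\<bar>z\<bar> + r < n" using reals_Archimedean2 by blast
  have "x \<in> insert 0 ((\<lambda>i. 4 ^ i) ` {..<n} \<union> (\<lambda>i. 4 ^ i + spread_pair_gap i) ` {..<n})"
    if x: "x \<in> spread_pairs" "dist x z \<le> r" for x
  proof (cases "x = 0")
    case False
    with x obtain i where i: "x = 4 ^ i \<or> x = 4 ^ i + spread_pair_gap i"
      by (auto simp: spread_pairs_def)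
    have "real i < 4 ^ i"
      by (rule of_nat_less_power_4)
    also have "4 ^ i \<le> x"
      using i spread_pair_gap_bounds(1)[of i] by (elim disjE) linarith+
    finally have "real i < x" .
    moreover have "x < real n"
      using n x(2) unfolding dist_real_def by linarith
    ultimately have "i < n" by simp
    with i show ?thesis by blast
  qed simp
  then have "{x \<in> spread_pairs. dist x z \<le> r} \<subseteq>
      insert 0 ((\<lambda>i. 4 ^ i) ` {..<n} \<union> (\<lambda>i. 4 ^ i + spread_pair_gap i) ` {..<n})"
    by blast
  then show ?thesis
    by (rule finite_subset) simp
qed

lemma proper_spread_pairs: "spread.proper"
  unfolding spread.proper_def
proof (intro allI impI)
  fix S assume S: "closedin spread.mtopology S \<and> spread.mbounded S"
  then obtain z r where "S \<subseteq> spread.mcball z r"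
    by (auto simp: spread.mbounded_def)
  then have "S \<subseteq> {x \<in> spread_pairs. dist x z \<le> r}"
    by (auto simp: dist_commute)
  then have "finite S"
    using finite_bounded_spread_pairs finite_subset by blast
  then show "compactin spread.mtopology S"
    using closedin_subset[of spread.mtopology S] S by (intro finite_imp_compactin) auto
qed

lemma unbounded_spread_pairs: "\<not> spread.mbounded spread_pairs"
proof
  assume "spread.mbounded spread_pairs"
  then obtain z r where "spread_pairs \<subseteq> spread.mcball z r"
    by (auto simp: spread.mbounded_def)
  then have "spread_pairs \<subseteq> {x \<in> spread_pairs. dist x z \<le> r}"
    by (auto simp: dist_commute)
  then have "finite spread_pairs"
    using finite_bounded_spread_pairs finite_subset by blast
  then have "finite (range (\<lambda>i. 4 ^ i :: real))"
    by (rule finite_subset[rotated]) (auto simp: spread_pairs_def)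
  moreover have "inj (\<lambda>i. 4 ^ i :: real)"
    by (intro injI) simp
  ultimately show False
    using finite_imageD by blast
qed

text \<open>Within one label the gap is \<open>4^i\<close> to a fixed power, as
  \<open>indicator_higson_subpower\<close> demands. The choice function \<open>c\<close> treats both
  members of the pairs at once.\<close>

lemma indicator_spread_pairs_higson_subpower:
  assumes c: "\<And>i. c i \<in> {4 ^ i, 4 ^ i + spread_pair_gap i}"
  shows "indicator (c ` {i. fst (prod_decode i) = m}) \<in> spread.higson_subpower 0" (is "indicator ?S \<in> _")
proof (rule spread.indicator_higson_subpower)
  have "c i \<in> spread_pairs" for i
    using c[of i] by (auto simp: spread_pairs_def)
  then show "openin spread.mtopology ?S" "openin spread.mtopology (spread_pairs - ?S)"
    by (auto intro!: openin_spread_pairs)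
  let ?\<alpha> = "1 / (real m + 1)"
  fix x y assume "x \<in> ?S" and y: "y \<in> spread_pairs - ?S"
  then obtain i where i: "x = c i" "fst (prod_decode i) = m" by auto
  have \<alpha>: "0 \<le> ?\<alpha>" "?\<alpha> \<le> 1" by (auto simp: field_simps)
  \<comment> \<open>The constant 1/4: replacing the norm, at most \<open>2 * 4^i\<close>, by
    \<open>4^i\<close> costs a factor of at most 2, and the separation of points another 2.\<close>
  have "dist x 0 powr ?\<alpha> \<le> (2 * 4 ^ i) powr ?\<alpha>"
    using c[of i] spread_pair_gap_bounds[of i] i by (intro powr_mono2) auto
  also have "\<dots> = 2 powr ?\<alpha> * spread_pair_gap i"
    by (simp add: powr_mult spread_pair_gap_def i)
  also have "\<dots> \<le> 2 powr 1 * spread_pair_gap i"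
    using \<alpha> spread_pair_gap_bounds(1)[of i] by (intro mult_right_mono powr_mono) auto
  finally have "1 / 4 * dist x 0 powr ?\<alpha> \<le> spread_pair_gap i / 2" by simp
  also have "\<dots> \<le> dist x y"
    using spread_pairs_separated[of x i y] c[of i] i y \<open>x \<in> ?S\<close> by auto
  finally show "1 / 4 * dist x 0 powr ?\<alpha> \<le> dist x y" .
qed (auto simp: spread_pairs_def)

theorem corollary3p4:
  shows "\<exists>(M::real set) (d::real \<Rightarrow> real \<Rightarrow> real) x0.
    Metric_space M d \<and> Metric_space.proper M d \<and> \<not> Metric_space.mbounded M d M \<and> x0 \<in> M \<and>
    (let \<nu> = Metric_space.higson_corona M d x0 in
      \<exists>D \<subseteq> topspace \<nu>. sigma_compactin \<nu> D \<and>
        \<not> equivalent_compactifications (subtopology \<nu> D)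
            (Stone_Cech (subtopology \<nu> D)) (Stone_Cech_embedding (subtopology \<nu> D))
            (subtopology \<nu> (\<nu> closure_of D)) (\<lambda>y. y))"
proof -
  let ?a = "\<lambda>i. 4 ^ i :: real" and ?b = "\<lambda>i. 4 ^ i + spread_pair_gap i"
  have lim: "filterlim (\<lambda>i. c i) at_top sequentially" if "\<And>i. 4 ^ i \<le> c i" for c :: "nat \<Rightarrow> real"
  proof (rule filterlim_at_top_mono[OF filterlim_real_sequentially])
    show "\<forall>\<^sub>F i in sequentially. real i \<le> c i"
      using that of_nat_less_power_4 by (intro always_eventually allI) (meson less_imp_le order_trans)
  qed
  have "\<exists>D \<subseteq> topspace (spread.higson_corona 0). sigma_compactin (spread.higson_corona 0) D \<and>
        \<not> equivalent_compactifications (subtopology (spread.higson_corona 0) D)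
            (Stone_Cech (subtopology (spread.higson_corona 0) D))
            (Stone_Cech_embedding (subtopology (spread.higson_corona 0) D))
            (subtopology (spread.higson_corona 0) (spread.higson_corona 0 closure_of D)) (\<lambda>y. y)"
  proof (rule spread.not_equivalent_Stone_Cech[OF proper_spread_pairs,
        of 0 ?a ?b "\<lambda>i. fst (prod_decode i)"])
    show "range ?a \<inter> range ?b = {}"
    proof (rule ccontr)
      assume "range ?a \<inter> range ?b \<noteq> {}"
      then obtain i j where ij: "?a j = ?b i" by auto
      \<comment> \<open>Gaps between 1 and \<open>4^i\<close> place \<open>?b i\<close> strictly
        between \<open>4^i\<close> and \<open>4^(i+1)\<close>, where there is no power of 4.\<close>
      have "i < j" "j < Suc i"
        using ij spread_pair_gap_bounds[of i] power_strict_increasing_iff[of "4::real" i j]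
          power_strict_increasing_iff[of "4::real" j "Suc i"] zero_less_power[of "4::real" i] 
        by (auto simp del: power_strict_increasing_iff)
      then show False by simp
    qed
    show "filterlim (\<lambda>i. dist (?a i) 0) at_top sequentially"
      by (rule lim) simp
    show "filterlim (\<lambda>i. dist (?b i) 0) at_top sequentially"
    proof (rule lim)
      show "4 ^ i \<le> dist (?b i) 0" for i
        using spread_pair_gap_bounds(1)[of i] unfolding dist_real_def by linarith
    qed
    show "dist (?a i) (?b i) \<le> dist (?a i) 0 powr (1 / (real (fst (prod_decode i)) + 1))" for i
      by (simp add: dist_real_def spread_pair_gap_def)
    show "infinite {i. fst (prod_decode i) = m}" for m
    proof -
      have "range (\<lambda>n. prod_encode (m, n)) \<subseteq> {i. fst (prod_decode i) = m}" by auto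
      moreover have "infinite (range (\<lambda>n. prod_encode (m, n)))"
        by (intro range_inj_infinite injI) auto
      ultimately show ?thesis
        using finite_subset by blast
    qed
    show "0 \<in> spread_pairs" "range ?a \<subseteq> spread_pairs" "range ?b \<subseteq> spread_pairs"
      by (auto simp: spread_pairs_def)
  qed (auto intro!: indicator_spread_pairs_higson_subpower)
  moreover have "0 \<in> spread_pairs" by (simp add: spread_pairs_def)
  ultimately show ?thesis
    using proper_spread_pairs unbounded_spread_pairs spread.Metric_space_axioms
    unfolding Let_def by blast
qed

end
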